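(* There exists $\kappa > 0$ such that $$\log \left|\mathbb{Z}[T]/(T^N-1,(T+1)^N-1)\right| = \frac{3\sqrt{3}}{4\pi}L(2,\chi_3) N^2 + \mathcal{O}(N^{2-\kappa}),$$ where $N$ ranges over all $N \in \mathbb{N}$ such that $6 \nmid N$, and $\chi_3$ denotes the non-trivial Dirichlet character modulo $3$.
   Context: Here $\mathbb{N}=\{1,2,\dots\}$, $|R|$ denotes the cardinality of a ring $R$, and $L(s,\chi_3)$ is the Dirichlet $L$-function of $\chi_3$. The implied constant in $\mathcal{O}$ is independent of $N$. *)

theory Defs
  imports
    "HOL-Analysis.Analysis"
    "HOL-Algebra.Algebra"
    "HOL-Algebra.Algebraic_Closure_Type"
    "HOL-Computational_Algebra.Polynomial"
begin

section \<open>Dirichlet characters and their $L$-functions\<close>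

definition dirichlet_character :: "nat \<Rightarrow> (int \<Rightarrow> complex) \<Rightarrow> bool" where
  "dirichlet_character m \<psi> \<longleftrightarrow>
     (\<forall>a b. \<psi> (a * b) = \<psi> a * \<psi> b) \<and>
     (\<forall>a. \<psi> (a + int m) = \<psi> a) \<and>
     (\<forall>a. \<psi> a \<noteq> 0 \<longleftrightarrow> coprime a (int m))"

definition principal_character :: "nat \<Rightarrow> int \<Rightarrow> complex" where
  "principal_character m a = (if coprime a (int m) then 1 else 0)"

text \<open>
  The Dirichlet series of \<open>\<psi>\<close>. It is the $L$-function only where the series converges, in
  particular on the half plane \<open>Re s > 1\<close>; no analytic continuation is involved.
\<close>
definition dirichlet_L :: "complex \<Rightarrow> (int \<Rightarrow> complex) \<Rightarrow> complex" where
  "dirichlet_L s \<psi> = suminf (\<lambda>n. \<psi> (int (Suc n)) / of_nat (Suc n) powr s)"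

definition chi3 :: "int \<Rightarrow> complex" where
  "chi3 a = (if a mod 3 = 1 then 1 else if a mod 3 = 2 then -1 else 0)"

lemma mod3_cases:
  fixes a :: int
  obtains "a mod 3 = 0" | "a mod 3 = 1" | "a mod 3 = 2"
proof -
  have "a mod 3 = 0 \<or> a mod 3 = 1 \<or> a mod 3 = 2"
    by presburger
  thus ?thesis
    by (elim disjE) (erule that)+
qed

lemma coprime_3_iff: "coprime (a :: int) 3 \<longleftrightarrow> a mod 3 \<noteq> 0"
proof -
  have "coprime a 3 \<longleftrightarrow> coprime (a mod 3) 3"
    by simp
  also have "\<dots> \<longleftrightarrow> a mod 3 \<noteq> 0"
    by (cases a rule: mod3_cases) (auto simp: coprime_iff_gcd_eq_1 gcd_non_0_int)
  finally show ?thesis .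
qed

text \<open>\<open>chi3\<close> is indeed the only non-trivial Dirichlet character modulo 3.\<close>
lemma dirichlet_character_3_iff:
  "dirichlet_character 3 \<psi> \<and> \<psi> \<noteq> principal_character 3 \<longleftrightarrow> \<psi> = chi3"
proof
  assume *: "\<psi> = chi3"
  have "chi3 (a * b) = chi3 a * chi3 b" for a b
  proof -
    have red: "chi3 c = chi3 (c mod 3)" for c
      unfolding chi3_def mod_mod_trivial ..
    have "chi3 (a * b) = chi3 ((a mod 3) * (b mod 3))"
      unfolding chi3_def mod_mult_eq ..
    also have "\<dots> = chi3 (a mod 3) * chi3 (b mod 3)"
      by (cases a rule: mod3_cases; cases b rule: mod3_cases; simp only:) (simp_all add: chi3_def)
    finally show ?thesis
      unfolding red[of a, symmetric] red[of b, symmetric] .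
  qed
  moreover have "chi3 a \<noteq> 0 \<longleftrightarrow> coprime a 3" for a
    by (cases a rule: mod3_cases) (simp_all add: chi3_def coprime_3_iff)
  moreover have "chi3 (a + 3) = chi3 a" for a
    by (simp add: chi3_def)
  moreover have "chi3 \<noteq> principal_character 3"
  proof
    assume "chi3 = principal_character 3"
    hence "chi3 2 = principal_character 3 2"
      by (rule fun_cong)
    thus False
      by (simp add: chi3_def principal_character_def coprime_3_iff)
  qed
  ultimately show "dirichlet_character 3 \<psi> \<and> \<psi> \<noteq> principal_character 3"
    unfolding * dirichlet_character_def of_nat_numeral by blast
next
  assume *: "dirichlet_character 3 \<psi> \<and> \<psi> \<noteq> principal_character 3"
  hence char: "dirichlet_character 3 \<psi>"
    by (rule conjunct1)
  have mult: "\<psi> (a * b) = \<psi> a * \<psi> b" for a b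
    using char unfolding dirichlet_character_def by (elim conjE allE)
  have per: "\<psi> (a + 3) = \<psi> a" for a
    using char unfolding dirichlet_character_def of_nat_numeral by (elim conjE allE)
  have nz: "\<psi> a \<noteq> 0 \<longleftrightarrow> a mod 3 \<noteq> 0" for a
    using char unfolding dirichlet_character_def of_nat_numeral coprime_3_iff by (elim conjE allE)
  have nat_per: "\<psi> (a + 3 * int n) = \<psi> a" for a n
  proof (induction n)
    case (Suc n)
    thus ?case
      using per[of "a + 3 * int n"] by (simp add: algebra_simps)
  qed simp
  have red: "\<psi> a = \<psi> (a mod 3)" for a
  proof (cases "a div 3 \<ge> 0")
    case True
    thus ?thesis
      using nat_per[of "a mod 3" "nat (a div 3)"] by simp
  next
    case False
    moreover have "a + 3 * (- (a div 3)) = a mod 3"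
      using mult_div_mod_eq[of 3 a] by linarith
    ultimately show ?thesis
      using nat_per[of a "nat (- (a div 3))"] by simp
  qed
  have zero: "\<psi> 0 = 0"
    using nz[of 0] by (simp only: mod_0 simp_thms)
  have "\<psi> 1 = \<psi> 1 * \<psi> 1"
    using mult[of 1 1] by (simp only: mult_1)
  moreover have "\<psi> 1 \<noteq> 0"
    unfolding nz by simp
  ultimately have one: "\<psi> 1 = 1"
    by (simp only: mult_cancel_left1 simp_thms)
  have "\<psi> 4 = \<psi> 1"
    by (rule trans[OF red]) simp
  hence "\<psi> 2 * \<psi> 2 = 1"
    using mult[of 2 2] one by (simp only: mult_num_simps) simp
  hence "\<psi> 2 = 1 \<or> \<psi> 2 = -1"
    by (simp add: square_eq_1_iff)
  moreover have "\<psi> 2 \<noteq> 1"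
  proof
    assume two: "\<psi> 2 = 1"
    have "\<psi> (a mod 3) = principal_character 3 a" for a
      by (cases a rule: mod3_cases)
         (simp_all only: zero one two principal_character_def, simp_all add: coprime_3_iff)
    hence "\<psi> a = principal_character 3 a" for a
      by (rule trans[OF red])
    hence "\<psi> = principal_character 3"
      by (rule ext)
    with * show False
      by blast
  qed
  ultimately have two: "\<psi> 2 = -1"
    by blast
  have "\<psi> (a mod 3) = chi3 a" for a
    by (cases a rule: mod3_cases) (simp_all only: zero one two chi3_def, simp_all)
  hence "\<psi> a = chi3 a" for a
    by (rule trans[OF red])
  thus "\<psi> = chi3"
    by (rule ext)
qed

lemma summable_dirichlet_L_2_chi3:
  "summable (\<lambda>n. chi3 (int (Suc n)) / of_nat (Suc n) powr 2)"
proof (rule summable_comparison_test')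
  show "summable (\<lambda>n. inverse (real (Suc n) ^ 2))"
    using inverse_power_summable[of 2, where 'a = real]
    by (subst summable_Suc_iff[of "\<lambda>n. inverse (real n ^ 2)"]) simp
next
  fix n :: nat
  have "(of_nat (Suc n) :: complex) powr 2 = of_nat (Suc n) ^ 2"
    using powr_nat'[of "of_nat (Suc n) :: complex" 2] by (simp del: of_nat_Suc)
  moreover have "norm (chi3 (int (Suc n))) \<le> 1"
    unfolding chi3_def by simp
  ultimately show "norm (chi3 (int (Suc n)) / of_nat (Suc n) powr 2) \<le> inverse (real (Suc n) ^ 2)"
    unfolding inverse_eq_divide
    by (simp only: norm_divide norm_power norm_of_nat) (rule divide_right_mono, simp_all)
qed

section \<open>The quotient ring\<close>

abbreviation int_poly_ring :: "int poly ring" where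
  "int_poly_ring \<equiv> ring_of_type_algebra"

text \<open>$\mathbb{Z}[T]/(T^N-1, (T+1)^N-1)$, where \<open>T = [:0, 1:]\<close>\<close>
definition quotient_ring :: "nat \<Rightarrow> int poly set ring" where
  "quotient_ring N =
     int_poly_ring Quot (Idl\<^bsub>int_poly_ring\<^esub> {[:0, 1:] ^ N - 1, ([:0, 1:] + 1) ^ N - 1})"

end

(*
  Multiplication by g on Z[T]/(f), f monic with distinct roots, has determinant equal to the product
  of the values g(z) over the roots z of f, and |Z[T]/(f, g)| is its absolute value. For f = T^N - 1
  and g = (T+1)^N - 1 the logarithm of the cardinality is the sum of log |(1+z)^N - 1| over the N-th
  roots of unity z.

  For such z, the quantity | |1+z|^2 - 1 | = |z^3 - 1| / |z - 1| is either 0 or at least 1/N, as z^3 is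
  again an N-th root of unity. In the second case |1+z|^N stays away from 1; in the first z is a
  primitive cube root of unity, and (1+z)^N = -1 because N is divisible by 3 but not by 6. So each
  summand is N log^+ |1+z| + O(1), and the sum over z is a Riemann sum of a Lipschitz function with
  error O(1). This gives the error term O(N), that is, kappa = 1.

  The limiting integral of log^+ |1 + e^(2 pi i t)| (the Mahler measure of 1 + x + y) is evaluated
  with the primitive Im Li(e^(2 pi i t)) / (2 pi) of log |1 + e^(2 pi i t)|, where Li(z) is the sum of
  (-1)^(n+1) z^n / n^2; at the cube roots of unity it is a multiple of L(2, chi_3).
*)
theory Submission
  imports Defs "Jordan_Normal_Form.Char_Poly"
begin

hide_const (open) up_ring.coeff up_ring.monom Module.smult Polynomials.degree Polynomials.lead_coeff

section \<open>Determinants of coefficient matrices\<close>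

lemma monic_division:
  fixes f p :: "'a :: comm_ring_1 poly"
  assumes "lead_coeff f = 1"
  obtains q r where "p = q * f + r" "r = 0 \<or> degree r < degree f"
proof -
  obtain q r where qr: "pseudo_divmod p f = (q, r)"
    by fastforce
  have "f \<noteq> 0"
    using assms by auto
  from pseudo_divmod[OF this qr] assms have "p = q * f + r" "r = 0 \<or> degree r < degree f"
    by (simp_all add: mult.commute)
  thus thesis
    by (rule that)
qed

definition coeff_mat :: "nat \<Rightarrow> (nat \<Rightarrow> 'a :: comm_ring_1 poly) \<Rightarrow> 'a Matrix.mat" where
  "coeff_mat n b = Matrix.mat n n (\<lambda>(i, j). coeff (b i) j)"

lemma coeff_mat_carrier [simp]: "coeff_mat n b \<in> carrier_mat n n"
  by (simp add: coeff_mat_def)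

lemma det_coeff_mat_dvd:
  assumes "\<And>i. i < n \<Longrightarrow> r i = (\<Sum>k<n. smult (c i k) (b k))"
  shows "Determinant.det (coeff_mat n b) dvd Determinant.det (coeff_mat n r)"
proof -
  define C where "C = Matrix.mat n n (\<lambda>(i, k). c i k)"
  have "coeff_mat n r = C * coeff_mat n b"
    by (rule eq_matI)
       (auto simp: C_def coeff_mat_def scalar_prod_def assms coeff_sum atLeast0LessThan)
  moreover have "C \<in> carrier_mat n n"
    by (simp add: C_def)
  ultimately show ?thesis
    by (simp add: Determinant.det_mult[OF _ coeff_mat_carrier])
qed

lemma det_coeff_mat_triangular:
  assumes "\<And>i j. i < j \<Longrightarrow> j < n \<Longrightarrow> coeff (b i) j = 0"
  shows "Determinant.det (coeff_mat n b) = (\<Prod>i<n. coeff (b i) i)"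
proof -
  have "Determinant.det (coeff_mat n b) = prod_list (diag_mat (coeff_mat n b))"
    by (rule Determinant.det_lower_triangular[OF _ coeff_mat_carrier])
       (use assms in \<open>auto simp: coeff_mat_def\<close>)
  also have "\<dots> = (\<Prod>i<n. coeff (b i) i)"
    by (auto simp: prod_list_diag_prod coeff_mat_def atLeast0LessThan)
  finally show ?thesis .
qed

lemma det_coeff_mat_eval:
  fixes r :: "nat \<Rightarrow> 'a :: field poly"
  assumes Z: "finite Z" "card Z = n"
    and deg: "\<And>i j. i < n \<Longrightarrow> n \<le> j \<Longrightarrow> coeff (r i) j = 0"
    and ev: "\<And>i z. i < n \<Longrightarrow> z \<in> Z \<Longrightarrow> poly (r i) z = z ^ i * g z"
  shows "Determinant.det (coeff_mat n r) = (\<Prod>z\<in>Z. g z)"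
proof -
  obtain z where z: "bij_betw z {..<n} Z"
    using ex_bij_betw_nat_finite[OF Z(1)] Z(2) by (auto simp: atLeast0LessThan)
  have zZ: "z k \<in> Z" if "k < n" for k
    using z that by (auto simp: bij_betw_def)
  define P where "P = Matrix.mat n n (\<lambda>(j, k). z k ^ j)"
  define D where "D = Matrix.mat n n (\<lambda>(j, k). if j = k then g (z k) else 0)"
  have [simp]: "P \<in> carrier_mat n n" "D \<in> carrier_mat n n"
    by (simp_all add: P_def D_def)
  have poly_eq: "poly p x = (\<Sum>j<n. coeff p j * x ^ j)"
    if "\<And>j. n \<le> j \<Longrightarrow> coeff p j = 0" for p :: "'a poly" and x
  proof -
    have "poly p x = (\<Sum>j\<le>degree p. coeff p j * x ^ j)"
      by (rule poly_altdef)
    also have "\<dots> = (\<Sum>j\<in>{..degree p} \<inter> {..<n}. coeff p j * x ^ j)"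
      by (rule sum.mono_neutral_right) (use that in auto)
    also have "\<dots> = (\<Sum>j<n. coeff p j * x ^ j)"
      by (rule sum.mono_neutral_left) (auto simp: coeff_eq_0)
    finally show ?thesis .
  qed
  \<comment> \<open>\<open>P\<close> is the Vandermonde matrix of \<open>Z\<close>, so \<open>coeff_mat n r\<close> is conjugate to a diagonal matrix.\<close>
  have "coeff_mat n r * P = P * D"
  proof (rule eq_matI)
    fix i k assume "i < dim_row (P * D)" "k < dim_col (P * D)"
    hence ik: "i < n" "k < n"
      by (simp_all add: P_def D_def)
    have "(coeff_mat n r * P) $$ (i, k) = (\<Sum>j<n. coeff (r i) j * z k ^ j)"
      using ik by (simp add: coeff_mat_def P_def scalar_prod_def atLeast0LessThan)
    also have "\<dots> = poly (r i) (z k)"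
      using deg ik by (intro poly_eq [symmetric]) auto
    also have "\<dots> = z k ^ i * g (z k)"
      using ik zZ by (intro ev) auto
    also have "\<dots> = (P * D) $$ (i, k)"
      using ik by (simp add: P_def D_def scalar_prod_def atLeast0LessThan if_distrib
                        sum.delta' cong: if_cong)
    finally show "(coeff_mat n r * P) $$ (i, k) = (P * D) $$ (i, k)" .
  qed (simp_all add: coeff_mat_def P_def D_def)
  hence "Determinant.det (coeff_mat n r) * Determinant.det P = Determinant.det P * Determinant.det D"
    using Determinant.det_mult[of "coeff_mat n r" n P] Determinant.det_mult[of P n D] by auto
  moreover have "Determinant.det P \<noteq> 0"
  proof
    assume "Determinant.det P = 0"
    hence "Determinant.det (transpose_mat P) = 0"
      by (simp add: Determinant.det_transpose[of P n])
    then obtain v where v: "v \<in> carrier_vec n" "v \<noteq> 0\<^sub>v n" "transpose_mat P *\<^sub>v v = 0\<^sub>v n"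
      using Determinant.det_0_iff_vec_prod_zero[of "transpose_mat P" n] by auto
    define p where "p = (\<Sum>j<n. monom (vec_index v j) j)"
    have cp: "coeff p j = (if j < n then vec_index v j else 0)" for j
      by (simp add: p_def coeff_sum)
    have "poly p x = 0" if "x \<in> Z" for x
    proof -
      from that z obtain k where k: "k < n" "x = z k"
        by (auto simp: bij_betw_def)
      have "0 = vec_index (transpose_mat P *\<^sub>v v) k"
        using v k by simp
      also have "\<dots> = (\<Sum>j<n. vec_index v j * z k ^ j)"
        using k v(1) by (simp add: P_def scalar_prod_def atLeast0LessThan mult.commute)
      also have "\<dots> = poly p x"
        using k by (subst poly_eq) (auto simp: cp)
      finally show ?thesis ..
    qed
    hence sub: "Z \<subseteq> {x. poly p x = 0}"
      by auto
    have "p \<noteq> 0"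
    proof
      assume "p = 0"
      hence "vec_index v j = 0" if "j < n" for j
        using cp[of j] that by simp
      with v(1,2) show False
        by (metis eq_vecI carrier_vecD index_zero_vec(1) index_zero_vec(2))
    qed
    have "n \<le> card {x. poly p x = 0}"
      using card_mono[OF poly_roots_finite[OF \<open>p \<noteq> 0\<close>] sub] Z by simp
    also have "\<dots> \<le> degree p"
      using \<open>p \<noteq> 0\<close> by (rule card_poly_roots_bound)
    finally have "coeff p (degree p) = 0"
      by (simp add: cp)
    with \<open>p \<noteq> 0\<close> show False
      by simp
  qed
  ultimately have "Determinant.det (coeff_mat n r) = Determinant.det D"
    by simp
  also have "\<dots> = prod_list (diag_mat D)"
    by (rule Determinant.det_lower_triangular[of n]) (auto simp: D_def)
  also have "\<dots> = (\<Prod>k<n. g (z k))"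
    by (simp add: prod_list_diag_prod D_def atLeast0LessThan)
  also have "\<dots> = (\<Prod>z\<in>Z. g z)"
    using z by (rule prod.reindex_bij_betw)
  finally show ?thesis .
qed

section \<open>Quotients of $\mathbb{Z}[T]$\<close>

lemma int_poly_ring_simps:
  "carrier int_poly_ring = UNIV" "\<zero>\<^bsub>int_poly_ring\<^esub> = 0"
  "p \<oplus>\<^bsub>int_poly_ring\<^esub> q = p + q" "p \<otimes>\<^bsub>int_poly_ring\<^esub> q = p * q"
  by (simp_all add: ring_of_type_algebra_def)

lemma cring_int_poly_ring: "cring int_poly_ring"
  by (rule cring_from_type_algebra)

lemma int_poly_ring_minus: "p \<ominus>\<^bsub>int_poly_ring\<^esub> q = p - q"
proof -
  interpret R: cring int_poly_ring
    by (rule cring_int_poly_ring)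
  have "\<ominus>\<^bsub>int_poly_ring\<^esub> q = - q"
    by (rule R.minus_equality) (simp_all add: int_poly_ring_simps)
  thus ?thesis
    by (simp add: a_minus_def int_poly_ring_simps)
qed

lemma ideal_int_poly_ringI:
  assumes "0 \<in> I" "\<And>p q. p \<in> I \<Longrightarrow> q \<in> I \<Longrightarrow> p + q \<in> I" "\<And>p q. p \<in> I \<Longrightarrow> q * p \<in> I"
  shows "ideal I int_poly_ring"
proof -
  interpret R: cring int_poly_ring
    by (rule cring_int_poly_ring)
  have neg: "- p \<in> I" if "p \<in> I" for p
    using assms(3)[OF that, of "-1"] by simp
  have inv: "inv\<^bsub>add_monoid int_poly_ring\<^esub> p = - p" for p
    using int_poly_ring_minus[of 0 p] by (simp add: a_minus_def a_inv_def int_poly_ring_simps)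
  show ?thesis
  proof (rule idealI)
    show "subgroup I (add_monoid int_poly_ring)"
      by (rule subgroup.intro, unfold inv) (simp_all add: int_poly_ring_simps assms neg)
  qed (use assms(3) in \<open>auto simp: int_poly_ring_simps R.ring_axioms mult.commute\<close>)
qed

lemma genideal_int_poly_ring_pair:
  "Idl\<^bsub>int_poly_ring\<^esub> {f, g} = {u * f + v * g |u v. True}"
proof -
  interpret R: cring int_poly_ring
    by (rule cring_int_poly_ring)
  let ?I = "Idl\<^bsub>int_poly_ring\<^esub> {f, g}"
  have "ideal {u * f + v * g |u v. True} int_poly_ring"
  proof (rule ideal_int_poly_ringI)
    show "0 \<in> {u * f + v * g |u v. True}"
      by (auto intro!: exI[of _ 0])
    fix p assume "p \<in> {u * f + v * g |u v. True}"
    then obtain u v where p: "p = u * f + v * g"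
      by blast
    show "q * p \<in> {u * f + v * g |u v. True}" for q
      unfolding p by (intro CollectI exI[of _ "q * u"] exI[of _ "q * v"]) (simp add: algebra_simps)
    fix q assume "q \<in> {u * f + v * g |u v. True}"
    then obtain u' v' where q: "q = u' * f + v' * g"
      by blast
    show "p + q \<in> {u * f + v * g |u v. True}"
      unfolding p q
      by (intro CollectI exI[of _ "u + u'"] exI[of _ "v + v'"]) (simp add: algebra_simps)
  qed
  hence "?I \<subseteq> {u * f + v * g |u v. True}"
  proof (rule R.genideal_minimal)
    have "f = 1 * f + 0 * g" "g = 0 * f + 1 * g"
      by simp_all
    thus "{f, g} \<subseteq> {u * f + v * g |u v. True}"
      by blast
  qed
  moreover have "u * f + v * g \<in> ?I" for u v
  proof -
    interpret I: ideal ?I int_poly_ring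
      by (rule R.genideal_ideal) (simp add: int_poly_ring_simps)
    have "f \<in> ?I" "g \<in> ?I"
      using R.genideal_self[of "{f, g}"] by (auto simp: int_poly_ring_simps)
    hence "u \<otimes>\<^bsub>int_poly_ring\<^esub> f \<oplus>\<^bsub>int_poly_ring\<^esub> v \<otimes>\<^bsub>int_poly_ring\<^esub> g \<in> ?I"
      by (intro I.a_closed I.I_l_closed) (simp_all add: int_poly_ring_simps)
    thus ?thesis
      by (simp add: int_poly_ring_simps)
  qed
  ultimately show ?thesis
    by blast
qed

locale int_poly_ideal =
  fixes I :: "int poly set"
  assumes ideal: "ideal I int_poly_ring"
begin

lemma add_mem: "p \<in> I \<Longrightarrow> q \<in> I \<Longrightarrow> p + q \<in> I"
  using additive_subgroup.a_closed[OF ideal.axioms(1)[OF ideal]]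
  by (simp add: int_poly_ring_simps)

lemma mult_mem: "p \<in> I \<Longrightarrow> q * p \<in> I"
  using ideal.I_l_closed[OF ideal] by (simp add: int_poly_ring_simps)

lemma zero_mem: "0 \<in> I"
  using additive_subgroup.zero_closed[OF ideal.axioms(1)[OF ideal]]
  by (simp add: int_poly_ring_simps)

lemma minus_mem: "p \<in> I \<Longrightarrow> - p \<in> I"
  using mult_mem[of p "-1"] by simp

lemma diff_mem: "p \<in> I \<Longrightarrow> q \<in> I \<Longrightarrow> p - q \<in> I"
  using add_mem[of p "- q"] minus_mem[of q] by simp

lemma smult_mem: "p \<in> I \<Longrightarrow> smult c p \<in> I"
  using mult_mem[of p "[:c:]"] by simp

lemma sum_mem: "(\<And>i. i \<in> A \<Longrightarrow> p i \<in> I) \<Longrightarrow> sum p A \<in> I"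
  by (induction A rule: infinite_finite_induct) (auto simp: zero_mem add_mem)

lemma minimal_lead_coeff:
  assumes "p \<in> I" "\<And>j. j > i \<Longrightarrow> coeff p j = 0" "coeff p i \<noteq> 0"
  obtains b where "b \<in> I" "\<And>j. j > i \<Longrightarrow> coeff b j = 0" "coeff b i > 0"
    "\<And>q. q \<in> I \<Longrightarrow> (\<And>j. j > i \<Longrightarrow> coeff q j = 0) \<Longrightarrow> coeff b i dvd coeff q i"
proof -
  define P where
    "P n \<longleftrightarrow> n > 0 \<and> (\<exists>b\<in>I. (\<forall>j>i. coeff b j = 0) \<and> coeff b i = int n)" for n
  have "P (nat \<bar>coeff p i\<bar>)"
  proof (cases "coeff p i > 0")
    case True
    with assms show ?thesis
      unfolding P_def by (intro conjI bexI[of _ p]) auto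
  next
    case False
    with assms minus_mem show ?thesis
      unfolding P_def by (intro conjI bexI[of _ "- p"]) auto
  qed
  hence *: "P (LEAST n. P n)"
    by (rule LeastI)
  then obtain b where b: "b \<in> I" "\<And>j. j > i \<Longrightarrow> coeff b j = 0"
    "coeff b i = int (LEAST n. P n)" "coeff b i > 0"
    unfolding P_def by auto
  have "coeff b i dvd coeff q i" if q: "q \<in> I" "\<And>j. j > i \<Longrightarrow> coeff q j = 0" for q
  proof (rule ccontr)
    assume "\<not> coeff b i dvd coeff q i"
    hence pos: "coeff q i mod coeff b i > 0"
      using b(4) pos_mod_sign[of "coeff b i" "coeff q i"] by (simp add: dvd_eq_mod_eq_0 less_le)
    define r where "r = q - smult (coeff q i div coeff b i) b"
    have "r \<in> I" "\<And>j. j > i \<Longrightarrow> coeff r j = 0" "coeff r i = coeff q i mod coeff b i"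
      using q b unfolding r_def by (auto simp: minus_div_mult_eq_mod intro!: diff_mem smult_mem)
    hence "P (nat (coeff q i mod coeff b i))"
      unfolding P_def using pos by auto
    hence "(LEAST n. P n) \<le> nat (coeff q i mod coeff b i)"
      by (rule Least_le)
    hence "coeff b i \<le> coeff q i mod coeff b i"
      using b(3) pos by linarith
    thus False
      using b(4) pos_mod_bound[of "coeff b i" "coeff q i"] by linarith
  qed
  with b show thesis
    by (intro that) auto
qed

end

text \<open>
  \<open>b i\<close> has the least positive leading coefficient among the elements of \<open>I\<close> of degree \<open>i\<close>, so
  every coset of \<open>I\<close> has exactly one representative with \<open>i\<close>-th coefficient in
  \<open>{0..<coeff (b i) i}\<close> for all \<open>i\<close>.
\<close>
locale int_poly_ideal_basis = int_poly_ideal +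
  fixes b :: "nat \<Rightarrow> int poly" and N :: nat
  assumes basis_mem: "b i \<in> I"
    and basis_degree: "i < j \<Longrightarrow> coeff (b i) j = 0"
    and basis_pos: "coeff (b i) i > 0"
    and basis_dvd: "p \<in> I \<Longrightarrow> (\<And>j. i < j \<Longrightarrow> coeff p j = 0) \<Longrightarrow> coeff (b i) i dvd coeff p i"
    and basis_monic: "N \<le> i \<Longrightarrow> coeff (b i) i = 1"
begin

lemma reduced_exists:
  assumes "\<And>j. n \<le> j \<Longrightarrow> coeff p j = 0"
  shows "\<exists>r. p - r \<in> I \<and> (\<forall>j. 0 \<le> coeff r j \<and> coeff r j < coeff (b j) j) \<and> (\<forall>j\<ge>n. coeff r j = 0)"
  using assms
proof (induction n arbitrary: p)
  case 0
  hence "p = 0"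
    by (simp add: poly_eqI)
  thus ?case
    by (intro exI[of _ 0]) (simp add: zero_mem basis_pos)
next
  case (Suc n)
  define c where "c = coeff p n mod coeff (b n) n"
  define q where "q = smult (coeff p n div coeff (b n) n) (b n)"
  define p' where "p' = p - q - monom c n"
  have "coeff p' j = 0" if "n \<le> j" for j
    using that Suc.prems[of j] basis_degree[of n j]
    by (cases "j = n") (auto simp: p'_def c_def q_def minus_div_mult_eq_mod)
  from Suc.IH[OF this] obtain r where r: "p' - r \<in> I"
    "\<And>j. 0 \<le> coeff r j \<and> coeff r j < coeff (b j) j" "\<And>j. n \<le> j \<Longrightarrow> coeff r j = 0"
    by auto
  have "p - (r + monom c n) = (p' - r) + q"
    by (simp add: p'_def)
  also have "\<dots> \<in> I"
    unfolding q_def by (intro add_mem r smult_mem basis_mem)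
  finally have "p - (r + monom c n) \<in> I" .
  moreover have "0 \<le> c" "c < coeff (b n) n"
    unfolding c_def using basis_pos[of n] by simp_all
  ultimately show ?case
    using r by (intro exI[of _ "r + monom c n"]) auto
qed

lemma reduced_unique:
  assumes "\<And>j. 0 \<le> coeff r j \<and> coeff r j < coeff (b j) j"
    and "\<And>j. 0 \<le> coeff s j \<and> coeff s j < coeff (b j) j" and "r - s \<in> I"
  shows "r = s"
proof (rule ccontr)
  assume "r \<noteq> s"
  define i where "i = degree (r - s)"
  have "coeff (r - s) i \<noteq> 0"
    using \<open>r \<noteq> s\<close> by (simp add: i_def del: coeff_diff)
  moreover have "coeff (b i) i dvd coeff (r - s) i"
    using assms(3) by (rule basis_dvd) (simp add: i_def coeff_eq_0 del: coeff_diff)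
  ultimately have "\<bar>coeff (b i) i\<bar> \<le> \<bar>coeff (r - s) i\<bar>"
    by (rule dvd_imp_le_int)
  with assms(1,2)[of i] show False
    by (simp add: abs_if split: if_splits)
qed

lemma span:
  assumes "p \<in> I" "\<And>j. n \<le> j \<Longrightarrow> coeff p j = 0"
  shows "\<exists>c. p = (\<Sum>k<n. smult (c k) (b k))"
  using assms
proof (induction n arbitrary: p)
  case 0
  thus ?case
    by (simp add: poly_eqI)
next
  case (Suc n)
  obtain a where a: "coeff p n = coeff (b n) n * a"
    using basis_dvd[OF Suc.prems(1), of n] Suc.prems(2) by (metis Suc_leI dvd_def)
  define p' where "p' = p - smult a (b n)"
  have "coeff p' j = 0" if "n \<le> j" for j
    using that Suc.prems(2)[of j] basis_degree[of n j] a
    by (cases "j = n") (auto simp: p'_def)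
  moreover have "p' \<in> I"
    unfolding p'_def by (intro diff_mem smult_mem basis_mem Suc.prems)
  ultimately obtain c where c: "p' = (\<Sum>k<n. smult (c k) (b k))"
    using Suc.IH by blast
  have "p = p' + smult a (b n)"
    by (simp add: p'_def)
  also have "\<dots> = (\<Sum>k<Suc n. smult ((c(n := a)) k) (b k))"
    by (simp add: c)
  finally show ?case
    by blast
qed

lemma bij_betw_quotient:
  "bij_betw (\<lambda>t. I +>\<^bsub>int_poly_ring\<^esub> (\<Sum>i<N. monom (t i) i))
     (\<Pi>\<^sub>E i\<in>{..<N}. {0..<coeff (b i) i}) (carrier (int_poly_ring Quot I))"
proof -
  interpret R: cring int_poly_ring
    by (rule cring_int_poly_ring)
  let ?p = "\<lambda>t :: nat \<Rightarrow> int. \<Sum>i<N. monom (t i) i"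
  let ?A = "\<Pi>\<^sub>E i\<in>{..<N}. {0..<coeff (b i) i}"
  have coset: "I +>\<^bsub>int_poly_ring\<^esub> p = I +>\<^bsub>int_poly_ring\<^esub> q \<longleftrightarrow> p - q \<in> I" for p q
    using R.quotient_eq_iff_same_a_r_cos[OF ideal, of p q]
    by (simp add: int_poly_ring_simps int_poly_ring_minus)
  have carr: "carrier (int_poly_ring Quot I) = range (\<lambda>p. I +>\<^bsub>int_poly_ring\<^esub> p)"
    by (auto simp: FactRing_def A_RCOSETS_def' int_poly_ring_simps)
  have cp: "coeff (?p t) j = (if j < N then t j else 0)" for t j
    by (simp add: coeff_sum)
  have bound: "0 \<le> coeff (?p t) j \<and> coeff (?p t) j < coeff (b j) j" if "t \<in> ?A" for t j
    using that basis_monic[of j] by (auto simp: cp PiE_iff)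
  show ?thesis
  proof (rule bij_betw_imageI)
    show "inj_on (\<lambda>t. I +>\<^bsub>int_poly_ring\<^esub> ?p t) ?A"
    proof (rule inj_onI)
      fix t t' assume *: "t \<in> ?A" "t' \<in> ?A"
        "I +>\<^bsub>int_poly_ring\<^esub> ?p t = I +>\<^bsub>int_poly_ring\<^esub> ?p t'"
      have "?p t = ?p t'"
        by (rule reduced_unique) (use * bound in \<open>auto simp: coset\<close>)
      hence "t j = t' j" if "j < N" for j
        using cp[of t j] cp[of t' j] that by simp
      thus "t = t'"
        using *(1,2) by (intro PiE_ext) auto
    qed
    show "(\<lambda>t. I +>\<^bsub>int_poly_ring\<^esub> ?p t) ` ?A = carrier (int_poly_ring Quot I)"
    proof (rule equalityI)
      show "carrier (int_poly_ring Quot I) \<subseteq> (\<lambda>t. I +>\<^bsub>int_poly_ring\<^esub> ?p t) ` ?A"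
      proof
        fix C assume "C \<in> carrier (int_poly_ring Quot I)"
        then obtain p where C: "C = I +>\<^bsub>int_poly_ring\<^esub> p"
          by (auto simp: carr)
        obtain r where r: "p - r \<in> I" "\<And>j. 0 \<le> coeff r j \<and> coeff r j < coeff (b j) j"
          using reduced_exists[of "Suc (degree p)" p] by (auto simp: coeff_eq_0)
        define t where "t = restrict (coeff r) {..<N}"
        have t: "t \<in> ?A"
          unfolding t_def using r(2) by auto
        have "coeff r j = 0" if "N \<le> j" for j
          using r(2)[of j] basis_monic[OF that] by simp
        hence "?p t = r"
          by (intro poly_eqI) (auto simp: cp t_def)
        with C r(1) have "C = I +>\<^bsub>int_poly_ring\<^esub> ?p t"
          by (simp add: coset)
        with t show "C \<in> (\<lambda>t. I +>\<^bsub>int_poly_ring\<^esub> ?p t) ` ?A"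
          by blast
      qed
    qed (auto simp: carr)
  qed
qed

lemma finite_quotient: "finite (carrier (int_poly_ring Quot I))"
  using bij_betw_finite[OF bij_betw_quotient] by (simp add: finite_PiE)

lemma card_quotient: "int (card (carrier (int_poly_ring Quot I))) = (\<Prod>i<N. coeff (b i) i)"
proof -
  have "int (card (carrier (int_poly_ring Quot I))) =
          int (card (\<Pi>\<^sub>E i\<in>{..<N}. {0..<coeff (b i) i}))"
    using bij_betw_same_card[OF bij_betw_quotient] by simp
  also have "\<dots> = (\<Prod>i<N. int (nat (coeff (b i) i)))"
    by (simp add: card_PiE)
  also have "\<dots> = (\<Prod>i<N. coeff (b i) i)"
    using basis_pos by (intro prod.cong) (auto simp: less_imp_le)
  finally show ?thesis .
qed

end

theorem card_int_poly_quotient: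
  fixes f g :: "int poly"
  defines "Z \<equiv> {z :: complex. poly (of_int_poly f) z = 0}"
  assumes monic: "lead_coeff f = 1" and separable: "card Z = degree f"
    and nz: "\<And>z. z \<in> Z \<Longrightarrow> poly (of_int_poly g) z \<noteq> 0"
  shows "finite (carrier (int_poly_ring Quot (Idl\<^bsub>int_poly_ring\<^esub> {f, g})))"
    and "real (card (carrier (int_poly_ring Quot (Idl\<^bsub>int_poly_ring\<^esub> {f, g})))) =
           (\<Prod>z\<in>Z. cmod (poly (of_int_poly g) z))"
proof -
  define N where "N = degree f"
  define I where "I = Idl\<^bsub>int_poly_ring\<^esub> {f, g}"
  have I_eq: "I = {u * f + v * g |u v. True}"
    unfolding I_def by (rule genideal_int_poly_ring_pair)
  interpret R: cring int_poly_ring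
    by (rule cring_int_poly_ring)
  interpret int_poly_ideal I
    unfolding I_def by (rule int_poly_ideal.intro, rule R.genideal_ideal, simp add: int_poly_ring_simps)
  have f0: "f \<noteq> 0"
    using monic by auto
  have "finite Z"
    unfolding Z_def using f0 by (intro poly_roots_finite) simp

  have "\<exists>q r. monom 1 k * g = q * f + r \<and> (\<forall>j\<ge>N. coeff r j = 0)" for k
    using monic_division[OF monic, of "monom 1 k * g"]
    by (metis N_def coeff_0 coeff_eq_0 order_less_le_trans)
  then obtain q r where r: "\<And>k. monom 1 k * g = q k * f + r k"
    and r_deg: "\<And>k j. N \<le> j \<Longrightarrow> coeff (r k) j = 0"
    by metis
  have r_mem: "r k \<in> I" for k
  proof -
    have "r k = (- q k) * f + monom 1 k * g"
      by (simp add: r)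
    thus ?thesis
      unfolding I_eq by blast
  qed

  define G where "G = coeff_mat N r"
  have [simp]: "G \<in> carrier_mat N N"
    by (simp add: G_def)
  have "of_int (Determinant.det G) = Determinant.det (map_mat complex_of_int G)"
    by simp
  also have "map_mat complex_of_int G = coeff_mat N (\<lambda>k. of_int_poly (r k))"
    by (auto simp: G_def coeff_mat_def)
  also have "Determinant.det \<dots> = (\<Prod>z\<in>Z. poly (of_int_poly g) z)"
  proof (rule det_coeff_mat_eval)
    fix i z assume "z \<in> Z"
    hence "poly (of_int_poly f) z = 0"
      by (simp add: Z_def)
    moreover have "poly (of_int_poly (monom 1 i * g)) z = poly (of_int_poly (q i * f + r i)) z"
      by (simp only: r)
    ultimately show "poly (of_int_poly (r i)) z = z ^ i * poly (of_int_poly g) z"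
      by (simp add: of_int_poly_hom.hom_mult of_int_poly_hom.hom_add poly_monom)
  qed (use \<open>finite Z\<close> separable r_deg in \<open>simp_all add: N_def\<close>)
  finally have detG: "of_int (Determinant.det G) = (\<Prod>z\<in>Z. poly (of_int_poly g) z)" .
  have "Determinant.det G \<noteq> 0"
  proof
    assume "Determinant.det G = 0"
    with detG have "(\<Prod>z\<in>Z. poly (of_int_poly g) z) = 0"
      by simp
    with \<open>finite Z\<close> nz show False
      by simp
  qed

  have "\<exists>p\<in>I. (\<forall>j>i. coeff p j = 0) \<and> coeff p i \<noteq> 0" for i
  proof (cases "i < N")
    case True
    define p where "p = (\<Sum>k<N. smult (adj_mat G $$ (i, k)) (r k))"
    have "coeff p j = Determinant.det G * (if i = j then 1 else 0)" if "j < N" for j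
    proof -
      have "coeff p j = (adj_mat G * G) $$ (i, j)"
        using True that adj_mat(1)[of G N]
        by (simp add: p_def coeff_sum scalar_prod_def G_def coeff_mat_def atLeast0LessThan)
      also have "adj_mat G * G = Determinant.det G \<cdot>\<^sub>m 1\<^sub>m N"
        by (rule adj_mat) simp
      also have "\<dots> $$ (i, j) = Determinant.det G * (if i = j then 1 else 0)"
        using True that by simp
      finally show ?thesis .
    qed
    moreover have "coeff p j = 0" if "N \<le> j" for j
      using that by (simp add: p_def coeff_sum r_deg)
    moreover have "p \<in> I"
      unfolding p_def by (intro sum_mem smult_mem r_mem)
    ultimately have "p \<in> I" "coeff p j = (if i = j then Determinant.det G else 0)" for j
      using True by (cases "j < N"; simp)+
    with \<open>Determinant.det G \<noteq> 0\<close> show ?thesis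
      by (intro bexI[of _ p]) simp_all
  next
    case False
    have "monom 1 (i - N) * f \<in> I"
      unfolding I_eq by (intro CollectI exI[of _ "monom 1 (i - N)"] exI[of _ 0]) simp
    moreover have "coeff (monom 1 (i - N) * f) i = 1"
      using False monic by (simp add: coeff_monom_mult N_def)
    moreover have "coeff (monom 1 (i - N) * f) j = 0" if "i < j" for j
      using False that by (simp add: coeff_monom_mult N_def coeff_eq_0)
    ultimately show ?thesis
      by (metis zero_neq_one)
  qed
  hence "\<exists>b. b \<in> I \<and> (\<forall>j>i. coeff b j = 0) \<and> coeff b i > 0 \<and>
           (\<forall>p\<in>I. (\<forall>j>i. coeff p j = 0) \<longrightarrow> coeff b i dvd coeff p i)" for i
    by (metis minimal_lead_coeff)
  then obtain b where b: "\<And>i. b i \<in> I" "\<And>i j. i < j \<Longrightarrow> coeff (b i) j = 0"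
    "\<And>i. coeff (b i) i > 0"
    "\<And>i p. p \<in> I \<Longrightarrow> (\<And>j. i < j \<Longrightarrow> coeff p j = 0) \<Longrightarrow> coeff (b i) i dvd coeff p i"
    by metis
  interpret int_poly_ideal_basis I b N
  proof
    fix i assume i: "N \<le> i"
    have "monom 1 (i - N) * f \<in> I"
      unfolding I_eq by (intro CollectI exI[of _ "monom 1 (i - N)"] exI[of _ 0]) simp
    hence "coeff (b i) i dvd coeff (monom 1 (i - N) * f) i"
      by (rule b(4)) (use i in \<open>simp add: coeff_monom_mult N_def coeff_eq_0\<close>)
    also have "coeff (monom 1 (i - N) * f) i = 1"
      using i monic by (simp add: coeff_monom_mult N_def)
    finally show "coeff (b i) i = 1"
      using b(3)[of i] by simp
  qed (use b in auto)

  \<comment> \<open>The polynomials \<open>b i\<close> and \<open>r i\<close>, for \<open>i < N\<close>, span the same lattice.\<close>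
  have "Determinant.det (coeff_mat N b) dvd Determinant.det G"
  proof -
    have "\<exists>c. r i = (\<Sum>k<N. smult (c k) (b k))" for i
      by (rule span) (simp_all add: r_mem r_deg)
    then obtain c where "\<And>i. r i = (\<Sum>k<N. smult (c i k) (b k))"
      by metis
    thus ?thesis
      unfolding G_def by (intro det_coeff_mat_dvd[of N r c b])
  qed
  moreover have "Determinant.det G dvd Determinant.det (coeff_mat N b)"
  proof -
    have "\<exists>c. b i = (\<Sum>k<N. smult (c k) (r k))" if "i < N" for i
    proof -
      obtain u v where uv: "b i = u * f + v * g"
        using b(1)[of i] unfolding I_eq by blast
      obtain s v' where v: "v = s * f + v'" "v' = 0 \<or> degree v' < degree f"
        using monic_division[OF monic] .
      have v'_deg: "coeff v' j = 0" if "N \<le> j" for j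
        using v(2) that by (auto simp: N_def coeff_eq_0)
      have "(\<Sum>k<N. smult (coeff v' k) (monom 1 k)) = v'"
        by (rule poly_eqI) (auto simp: smult_monom coeff_sum v'_deg not_less)
      hence "v' * g = (\<Sum>k<N. smult (coeff v' k) (monom 1 k)) * g"
        by simp
      also have "\<dots> = (\<Sum>k<N. smult (coeff v' k) (q k * f + r k))"
        by (simp add: sum_distrib_right r)
      also have "\<dots> = (\<Sum>k<N. smult (coeff v' k) (q k)) * f + (\<Sum>k<N. smult (coeff v' k) (r k))"
        by (simp add: smult_add_right sum.distrib sum_distrib_right)
      finally have eq: "b i - (\<Sum>k<N. smult (coeff v' k) (r k)) =
          (u + s * g + (\<Sum>k<N. smult (coeff v' k) (q k))) * f" (is "?lhs = ?c * f")
        unfolding uv v(1) by (simp add: algebra_simps)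
      have lhs_deg: "coeff ?lhs j = 0" if "N \<le> j" for j
        using that \<open>i < N\<close> b(2)[of i j] by (simp add: coeff_sum r_deg)
      have "?lhs = 0"
      proof (rule ccontr)
        assume "?lhs \<noteq> 0"
        with eq f0 have "N \<le> degree ?lhs"
          by (auto simp: degree_mult_eq N_def)
        with lhs_deg have "lead_coeff ?lhs = 0"
          by blast
        with \<open>?lhs \<noteq> 0\<close> show False
          by (simp only: leading_coeff_0_iff simp_thms)
      qed
      thus ?thesis
        by auto
    qed
    then obtain c where "\<And>i. i < N \<Longrightarrow> b i = (\<Sum>k<N. smult (c i k) (r k))"
      by metis
    thus ?thesis
      unfolding G_def by (intro det_coeff_mat_dvd[of N b c r])
  qed
  ultimately have "\<bar>Determinant.det G\<bar> = \<bar>Determinant.det (coeff_mat N b)\<bar>"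
    by (intro zdvd_antisym_abs)
  also have "\<dots> = (\<Prod>i<N. coeff (b i) i)"
    using b(3) by (simp add: det_coeff_mat_triangular b(2) prod_pos abs_of_pos)
  finally have "int (card (carrier (int_poly_ring Quot I))) = \<bar>Determinant.det G\<bar>"
    by (simp only: card_quotient)
  hence "real (card (carrier (int_poly_ring Quot I))) = \<bar>real_of_int (Determinant.det G)\<bar>"
    by linarith
  also have "\<dots> = cmod (of_int (Determinant.det G))"
    by simp
  also have "\<dots> = (\<Prod>z\<in>Z. cmod (poly (of_int_poly g) z))"
    unfolding detG by (simp add: prod_norm)
  finally show "real (card (carrier (int_poly_ring Quot (Idl\<^bsub>int_poly_ring\<^esub> {f, g})))) =
                  (\<Prod>z\<in>Z. cmod (poly (of_int_poly g) z))"
    unfolding I_def .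
  show "finite (carrier (int_poly_ring Quot (Idl\<^bsub>int_poly_ring\<^esub> {f, g})))"
    using finite_quotient unfolding I_def .
qed

section \<open>Roots of unity\<close>

lemma norm_root_of_unity:
  fixes z :: complex
  assumes "z ^ N = 1" "N > 0"
  shows "cmod z = 1"
proof -
  have "cmod z ^ N = 1 ^ N"
    using assms(1) by (metis norm_one norm_power power_one)
  thus ?thesis
    using assms(2) by (subst (asm) power_eq_iff_eq_base) auto
qed

text \<open>
  As \<open>(\<Sum>j<N. u ^ j) = 0\<close>, we have \<open>N = (\<Sum>j<N. 1 - u ^ j)\<close>, and the \<open>j\<close>-th term is at most
  \<open>j * cmod (u - 1)\<close>.
\<close>
lemma root_of_unity_dist_one:
  fixes u :: complex
  assumes "u ^ N = 1" "u \<noteq> 1" "N > 0"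
  shows "2 / N \<le> cmod (u - 1)"
proof -
  have u: "cmod u = 1"
    using assms by (intro norm_root_of_unity)
  have "(\<Sum>j<N. u ^ j) = 0"
    using assms by (simp add: sum_gp_strict)
  hence "of_nat N = (\<Sum>j<N. 1 - u ^ j)"
    by (simp add: sum_subtractf)
  hence "real N = cmod (\<Sum>j<N. 1 - u ^ j)"
    by (metis norm_of_nat)
  also have "\<dots> \<le> (\<Sum>j<N. real j * cmod (u - 1))"
  proof (rule sum_norm_le)
    fix j
    show "cmod (1 - u ^ j) \<le> real j * cmod (u - 1)"
      using norm_power_diff[of u 1 j] u by (simp add: norm_minus_commute)
  qed
  also have "\<dots> = (\<Sum>j<N. real j) * cmod (u - 1)"
    by (simp add: sum_distrib_right)
  also have "(\<Sum>j<N. real j) = real N * (real N - 1) / 2"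
    by (induction N) (auto simp: field_simps)
  also have "\<dots> * cmod (u - 1) \<le> real N * (real N * cmod (u - 1)) / 2"
    using assms(3) by (simp add: field_simps mult_left_mono)
  finally show ?thesis
    using assms(3) by (simp add: field_simps)
qed

lemma norm_cube_minus_one:
  assumes "cmod z = 1"
  shows "cmod (z ^ 3 - 1) = cmod (z - 1) * \<bar>cmod (1 + z) ^ 2 - 1\<bar>"
proof -
  have z: "z * cnj z = 1"
    using assms by (simp add: complex_norm_square[symmetric])
  have "z ^ 3 - 1 = (z - 1) * (z ^ 2 + z + 1)"
    by (simp add: algebra_simps power2_eq_square power3_eq_cube)
  also have "z ^ 2 + z + 1 = z * (z + z * cnj z + cnj z)"
    by (simp only: distrib_left z power2_eq_square mult_1_right)
  also have "z + z * cnj z + cnj z = (1 + z) * cnj (1 + z) - 1"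
    using z by (simp add: algebra_simps)
  also have "\<dots> = of_real (cmod (1 + z) ^ 2 - 1)"
    by (simp only: of_real_diff of_real_1 complex_norm_square)
  finally show ?thesis
    using assms by (simp add: norm_mult del: of_real_diff of_real_power)
qed

lemma power_away_from_one:
  fixes y :: real
  assumes "0 \<le> y" "1 / N \<le> \<bar>y - 1\<bar>" "N > 0"
  shows "2 \<le> y ^ N \<or> y ^ N \<le> 1 / 2"
proof -
  have two: "2 \<le> (1 + 1 / N) ^ N"
    using Bernoulli_inequality[of "1 / N" N] assms(3) by (simp add: field_simps)
  show ?thesis
  proof (cases "1 \<le> y")
    case True
    hence "(1 + 1 / N) ^ N \<le> y ^ N"
      using assms by (intro power_mono) auto
    with two show ?thesis
      by simp
  next
    case False
    hence "y * (1 + 1 / N) \<le> (1 - 1 / N) * (1 + 1 / N)"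
      using assms by (intro mult_right_mono) auto
    also have "\<dots> \<le> 1"
      by (simp add: algebra_simps)
    finally have "(y * (1 + 1 / N)) ^ N \<le> 1"
      using assms by (intro power_le_one) auto
    moreover have "y ^ N * 2 \<le> y ^ N * (1 + 1 / N) ^ N"
      using two assms(1) by (intro mult_left_mono) auto
    ultimately show ?thesis
      by (simp add: power_mult_distrib)
  qed
qed

lemma cube_root_of_unity_power:
  fixes z :: complex
  assumes "z ^ 3 = 1" "z \<noteq> 1" "z ^ N = 1" "\<not> 6 dvd N"
  shows "(1 + z) ^ N = -1"
proof -
  have "z ^ N = z ^ (3 * (N div 3) + N mod 3)"
    by simp
  also have "\<dots> = z ^ (N mod 3)"
    by (simp only: power_add power_mult assms(1)) simp
  finally have zm: "z ^ (N mod 3) = 1"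
    using assms(3) by simp
  have "N mod 3 = 0"
  proof (rule ccontr)
    assume "N mod 3 \<noteq> 0"
    then consider "N mod 3 = 1" | "N mod 3 = 2"
      by linarith
    thus False
    proof cases
      case 1
      with zm assms(2) show False by simp
    next
      case 2
      hence "z ^ 2 = 1"
        using zm by simp
      with assms(1,2) show False
        by (simp add: power3_eq_cube power2_eq_square)
    qed
  qed
  with assms(4) have "odd N"
    by presburger
  have "(z - 1) * (1 + z + z ^ 2) = 0"
    using assms(1) by (simp add: algebra_simps power2_eq_square power3_eq_cube)
  hence "1 + z = - (z ^ 2)"
    using assms(2) by (simp add: eq_neg_iff_add_eq_0)
  hence "(1 + z) ^ N = - ((z ^ N) ^ 2)"
    using \<open>odd N\<close> by (simp add: power_mult[symmetric] mult.commute)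
  thus ?thesis
    by (simp add: assms(3))
qed

lemma norm_power_minus_one_bounds:
  fixes z :: complex
  assumes "z ^ N = 1" "N > 0" "\<not> 6 dvd N"
  defines "x \<equiv> cmod (1 + z) ^ N" and "y \<equiv> cmod ((1 + z) ^ N - 1)"
  shows "max 1 x \<le> 4 * y" "y \<le> 4 * max 1 x"
proof -
  have z: "cmod z = 1"
    using assms by (intro norm_root_of_unity)
  have x: "x = cmod ((1 + z) ^ N)"
    by (simp add: x_def norm_power)
  have "y \<le> x + 1"
    unfolding x y_def using norm_triangle_ineq4[of "(1 + z) ^ N" 1] by simp
  thus "y \<le> 4 * max 1 x"
    by simp
  show "max 1 x \<le> 4 * y"
  proof (cases "z ^ 3 = 1 \<and> z \<noteq> 1")
    case True
    hence "(1 + z) ^ N = -1"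
      using assms by (intro cube_root_of_unity_power) auto
    thus ?thesis
      by (simp add: x y_def)
  next
    case False
    have "1 / N \<le> \<bar>cmod (1 + z) ^ 2 - 1\<bar>"
    proof (cases "z = 1")
      case True
      thus ?thesis
        using assms(2) by (simp add: field_simps)
    next
      case z1: False
      have "2 / N \<le> cmod (z ^ 3 - 1)"
        using assms(1,2) False z1
        by (intro root_of_unity_dist_one) (auto simp: power_mult[symmetric] mult.commute, simp add: power_mult)
      also have "\<dots> = cmod (z - 1) * \<bar>cmod (1 + z) ^ 2 - 1\<bar>"
        using z by (rule norm_cube_minus_one)
      also have "\<dots> \<le> 2 * \<bar>cmod (1 + z) ^ 2 - 1\<bar>"
        using norm_triangle_ineq4[of z 1] z by (intro mult_right_mono) auto
      finally show ?thesis
        by simp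
    qed
    hence "2 \<le> (cmod (1 + z) ^ 2) ^ N \<or> (cmod (1 + z) ^ 2) ^ N \<le> 1 / 2"
      using assms(2) by (intro power_away_from_one) auto
    moreover have "(cmod (1 + z) ^ 2) ^ N = x ^ 2"
      by (simp add: x_def power_mult[symmetric] mult.commute)
    ultimately have x2: "2 \<le> x ^ 2 \<or> x ^ 2 \<le> 1 / 2"
      by simp
    have "x \<ge> 0"
      by (simp add: x)
    have "4 / 3 \<le> x \<or> x \<le> 3 / 4"
    proof (rule ccontr)
      assume "\<not> ?thesis"
      hence "x ^ 2 < (4 / 3) ^ 2" "(3 / 4) ^ 2 < x ^ 2"
        using \<open>x \<ge> 0\<close> by (intro power_strict_mono; simp)+
      with x2 show False
        by (simp add: power2_eq_square)
    qed
    moreover have "\<bar>x - 1\<bar> \<le> y"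
      unfolding x y_def using norm_triangle_ineq3[of "(1 + z) ^ N" 1] by simp
    ultimately show ?thesis
      by linarith
  qed
qed

definition ln_plus :: "real \<Rightarrow> real" where
  "ln_plus x = ln (max 1 x)"

lemma abs_ln_diff_le:
  fixes x y c :: real
  assumes "0 < c" "c \<le> x" "c \<le> y"
  shows "\<bar>ln x - ln y\<bar> \<le> \<bar>x - y\<bar> / c"
proof -
  have *: "ln x - ln y \<le> \<bar>x - y\<bar> / c" if "c \<le> x" "c \<le> y" for x y
  proof -
    have "ln x - ln y \<le> (x - y) / y"
      using that assms(1) by (intro ln_diff_le) auto
    also have "\<dots> \<le> \<bar>x - y\<bar> / c"
      using that assms(1) by (intro frac_le) auto
    finally show ?thesis .
  qed
  from *[of x y] *[of y x] assms show ?thesis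
    by (simp add: abs_minus_commute abs_le_iff)
qed

lemma ln_plus_lipschitz: "\<bar>ln_plus x - ln_plus y\<bar> \<le> \<bar>x - y\<bar>"
proof -
  have "\<bar>ln_plus x - ln_plus y\<bar> \<le> \<bar>max 1 x - max 1 y\<bar>"
    using abs_ln_diff_le[of 1 "max 1 x" "max 1 y"] by (simp add: ln_plus_def)
  also have "\<dots> \<le> \<bar>x - y\<bar>"
    by (auto simp: max_def)
  finally show ?thesis .
qed

lemma ln_norm_power_minus_one:
  fixes z :: complex
  assumes "z ^ N = 1" "N > 0" "\<not> 6 dvd N"
  shows "\<bar>ln (cmod ((1 + z) ^ N - 1)) - N * ln_plus (cmod (1 + z))\<bar> \<le> ln 4"
proof -
  define x y where "x = cmod (1 + z) ^ N" and "y = cmod ((1 + z) ^ N - 1)"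
  have xy: "max 1 x \<le> 4 * y" "y \<le> 4 * max 1 x"
    using norm_power_minus_one_bounds[OF assms] by (simp_all add: x_def y_def)
  have "max 1 x = max 1 (cmod (1 + z)) ^ N"
    using assms(2) by (auto simp: x_def max_def power_le_one_iff intro: antisym)
  hence *: "N * ln_plus (cmod (1 + z)) = ln (max 1 x)"
    by (simp add: ln_plus_def ln_realpow)
  have "0 < y"
    using xy by linarith
  have "ln (max 1 x) \<le> ln (4 * y)" "ln y \<le> ln (4 * max 1 x)"
    using xy \<open>0 < y\<close> by (intro ln_mono; simp)+
  moreover have "ln (4 * y) = ln 4 + ln y" "ln (4 * max 1 x) = ln 4 + ln (max 1 x)"
    using \<open>0 < y\<close> by (intro ln_mult_pos; simp)+
  ultimately show ?thesis
    unfolding * y_def[symmetric] by (simp add: abs_le_iff)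
qed

lemma norm_cis_diff_le: "cmod (cis a - cis b) \<le> \<bar>a - b\<bar>"
proof -
  have "cis a - cis b = cis b * (cis (a - b) - 1)"
    by (simp add: right_diff_distrib cis_mult)
  hence "cis a - cis b = cis b * (exp (\<i> * of_real (a - b)) - 1)"
    by (simp only: cis_conv_exp)
  hence "cmod (cis a - cis b) = 2 * \<bar>sin ((a - b) / 2)\<bar>"
    by (simp only: norm_mult norm_cis dist_exp_i_1)
  also have "\<dots> \<le> 2 * \<bar>(a - b) / 2\<bar>"
    by (intro mult_left_mono abs_sin_x_le_abs_x) auto
  finally show ?thesis
    by simp
qed

lemma riemann_sum_lipschitz:
  fixes h :: "real \<Rightarrow> real" and N :: nat
  assumes lip: "\<And>s t. \<bar>h s - h t\<bar> \<le> L * \<bar>s - t\<bar>" and "N > 0"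
  shows "\<bar>(\<Sum>k<N. h (k / N)) - N * integral {0..1} h\<bar> \<le> L"
proof -
  have "L-lipschitz_on UNIV h"
    using lip order.trans[OF abs_ge_zero lip[of 1 0]] by (auto simp: lipschitz_on_def dist_real_def)
  hence cont: "continuous_on A h" for A
    using lipschitz_on_continuous_on continuous_on_subset by blast
  have "\<bar>(\<Sum>k<m. h (k / N)) - N * integral {0..m / N} h\<bar> \<le> L * m / N" for m :: nat
  proof (induction m)
    case (Suc m)
    let ?J = "integral {m / N..real (Suc m) / N} h"
    have "integral {0..real (Suc m) / N} h = integral {0..m / N} h + ?J"
      by (rule Henstock_Kurzweil_Integration.integral_combine [symmetric])
         (auto intro!: integrable_continuous_real cont divide_right_mono)
    moreover have "\<bar>h (m / N) - N * ?J\<bar> \<le> L / N"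
    proof -
      have "((\<lambda>t. h t - h (m / N)) has_integral ?J - (real (Suc m) / N - m / N) * h (m / N)) {m / N..real (Suc m) / N}"
        using has_integral_const_real[of "h (m / N)" "m / N" "real (Suc m) / N"]
        by (intro has_integral_diff integrable_integral integrable_continuous_real cont)
           (simp_all add: divide_right_mono)
      hence "norm (?J - (real (Suc m) / N - m / N) * h (m / N)) \<le> L / N * measure lborel (cbox (real m / N) (real (Suc m) / N))"
      proof (intro has_integral_bound)
        show "0 \<le> L / N"
          using order.trans[OF abs_ge_zero lip[of 1 0]] by simp
        fix t assume "t \<in> cbox (real m / N) (real (Suc m) / N)"
        hence "\<bar>t - m / N\<bar> \<le> 1 / N"
          by (auto simp: add_divide_distrib)
        hence "L * \<bar>t - m / N\<bar> \<le> L * (1 / N)"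
          using order.trans[OF abs_ge_zero lip[of 1 0]] by (intro mult_left_mono) auto
        with lip[of t "m / N"] show "norm (h t - h (m / N)) \<le> L / N"
          by simp
      qed simp
      hence "\<bar>?J - h (m / N) / N\<bar> \<le> L / N / N"
        by (simp add: content_real divide_right_mono add_divide_distrib)
      hence "N * \<bar>?J - h (m / N) / N\<bar> \<le> N * (L / N / N)"
        by (intro mult_left_mono) auto
      moreover have "N * \<bar>?J - h (m / N) / N\<bar> = \<bar>h (m / N) - N * ?J\<bar>"
        using assms(2) by (simp add: abs_mult_pos' right_diff_distrib abs_minus_commute)
      ultimately show ?thesis
        using assms(2) by simp
    qed
    ultimately show ?case
      using Suc by (simp add: algebra_simps add_divide_distrib)
  qed simp
  from this[of N] assms(2) show ?thesis
    by simp
qed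

section \<open>The integral and the $L$-value\<close>

text \<open>The term \<open>n = 0\<close> vanishes because \<open>x / 0 = 0\<close>.\<close>
definition alt_dilog :: "complex \<Rightarrow> complex" where
  "alt_dilog z = suminf (\<lambda>n. (-1) ^ Suc n / of_nat n ^ 2 * z ^ n)"

lemma norm_alt_dilog_term_le:
  assumes "cmod z \<le> 1"
  shows "cmod ((-1) ^ Suc n / of_nat n ^ 2 * z ^ n) \<le> inverse (real n ^ 2)"
proof -
  have "cmod ((-1) ^ Suc n / of_nat n ^ 2 * z ^ n) = inverse (real n ^ 2) * cmod z ^ n"
    by (simp add: norm_mult norm_divide norm_power inverse_eq_divide)
  also have "\<dots> \<le> inverse (real n ^ 2) * 1"
    using assms by (intro mult_left_mono power_le_one) auto
  finally show ?thesis
    by simp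
qed

lemma summable_alt_dilog:
  assumes "cmod z \<le> 1"
  shows "summable (\<lambda>n. (-1) ^ Suc n / of_nat n ^ 2 * z ^ n)"
  by (rule summable_comparison_test'[OF inverse_power_summable[of 2]])
     (use norm_alt_dilog_term_le[OF assms] in auto)

lemma alt_dilog_has_field_derivative:
  assumes "cmod z < 1"
  obtains d where "(alt_dilog has_field_derivative d) (at z)" "z * d = Ln (1 + z)"
proof -
  define c :: "nat \<Rightarrow> complex" where "c n = (-1) ^ Suc n / of_nat n ^ 2" for n
  define d where "d = suminf (\<lambda>n. diffs c n * z ^ n)"
  have sm: "summable (\<lambda>n. c n * x ^ n)" if "cmod x \<le> 1" for x
    unfolding c_def using that by (rule summable_alt_dilog)
  have "((\<lambda>z. suminf (\<lambda>n. c n * z ^ n)) has_field_derivative d) (at z)"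
    unfolding d_def using assms by (intro termdiffs_strong[of c 1] sm) auto
  also have "(\<lambda>z. suminf (\<lambda>n. c n * z ^ n)) = alt_dilog"
    by (simp add: fun_eq_iff alt_dilog_def c_def)
  finally have deriv: "(alt_dilog has_field_derivative d) (at z)" .
  have "summable (\<lambda>n. diffs c n * z ^ n)"
    using assms by (rule termdiff_converges) (auto intro: sm)
  hence "(\<lambda>n. diffs c n * z ^ n) sums d"
    by (simp add: d_def summable_sums)
  hence "(\<lambda>n. z * (diffs c n * z ^ n)) sums (z * d)"
    by (rule sums_mult)
  also have "(\<lambda>n. z * (diffs c n * z ^ n)) =
               (\<lambda>n. (-1) ^ Suc (Suc n) / of_nat (Suc n) * z ^ Suc n)"
    by (rule ext) (simp add: diffs_def c_def power2_eq_square del: of_nat_Suc)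
  finally have "(\<lambda>n. (-1) ^ Suc n / of_nat n * z ^ n) sums (z * d)"
    by (subst (asm) sums_Suc_iff) simp
  moreover have "(\<lambda>n. (-1) ^ Suc n / of_nat n * z ^ n) sums Ln (1 + z)"
    using assms by (rule Ln_series)
  ultimately have "z * d = Ln (1 + z)"
    by (rule sums_unique2)
  with deriv show thesis
    by (rule that)
qed

lemma alt_dilog_radial_limit:
  assumes "cmod w = 1" "r \<longlonglongrightarrow> 1" "\<And>m :: nat. 0 \<le> r m" "\<And>m. r m \<le> 1"
  shows "(\<lambda>m. alt_dilog (of_real (r m) * w)) \<longlonglongrightarrow> alt_dilog w"
proof -
  have lim: "(\<lambda>m. (-1) ^ Suc k / of_nat k ^ 2 * (of_real (r m) * w) ^ k)
           \<longlonglongrightarrow> (-1) ^ Suc k / of_nat k ^ 2 * (of_real 1 * w) ^ k" for k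
    by (intro tendsto_intros assms)
  have "cmod (of_real (r m) * w) \<le> 1" for m
    using assms by (simp add: norm_mult)
  hence bound: "\<forall>\<^sub>F (k, m) in at_top \<times>\<^sub>F sequentially.
           cmod ((-1) ^ Suc k / of_nat k ^ 2 * (of_real (r m) * w) ^ k) \<le> inverse (real k ^ 2)"
    by (intro always_eventually) (use norm_alt_dilog_term_le in blast)
  show ?thesis
    using tannerys_theorem[OF lim bound inverse_power_summable trivial_limit_sequentially]
    by (simp add: alt_dilog_def)
qed

lemma norm_one_plus_cis_ge:
  assumes "0 \<le> r" "r \<le> 1" "- 1 / 2 \<le> cos x"
  shows "1 / 2 \<le> cmod (1 + of_real r * cis x)"
proof -
  have "r * (- 1 / 2) \<le> r * cos x"
    using assms by (intro mult_left_mono) auto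
  hence "1 / 2 \<le> Re (1 + of_real r * cis x)"
    using assms by simp
  also have "\<dots> \<le> cmod (1 + of_real r * cis x)"
    by (rule complex_Re_le_cmod)
  finally show ?thesis .
qed

lemma integral_ln_norm_one_plus_cis_radius:
  assumes "a \<le> b" "0 \<le> r" "r < 1"
  shows "((\<lambda>t. ln (cmod (1 + of_real r * cis (2 * pi * t)))) has_integral
            (Im (alt_dilog (of_real r * cis (2 * pi * b)))
              - Im (alt_dilog (of_real r * cis (2 * pi * a)))) / (2 * pi)) {a..b}"
proof -
  define F where "F t = Im (alt_dilog (of_real r * cis (2 * pi * t))) / (2 * pi)" for t
  have "(F has_vector_derivative ln (cmod (1 + of_real r * cis (2 * pi * t)))) (at t)" for t
  proof -
    define z where "z = of_real r * cis (2 * pi * t)"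
    have z: "cmod z < 1"
      using assms by (simp add: z_def norm_mult)
    obtain d where d: "(alt_dilog has_field_derivative d) (at z)" "z * d = Ln (1 + z)"
      using alt_dilog_has_field_derivative[OF z] .
    have "1 + z \<noteq> 0"
    proof
      assume "1 + z = 0"
      hence "z = -1"
        by (simp add: eq_neg_iff_add_eq_0 add.commute)
      with z show False
        by simp
    qed
    hence "Im (2 * pi * \<i> * Ln (1 + z)) / (2 * pi) = ln (cmod (1 + z))"
      by simp
    hence im: "Im (2 * pi * \<i> * z * d) / (2 * pi) = ln (cmod (1 + z))"
      by (simp only: d(2) mult.assoc)
    have "((\<lambda>t. of_real r * cis (2 * pi * t)) has_vector_derivative 2 * pi * \<i> * z) (at t)"
      unfolding has_vector_derivative_def z_def
      by (auto intro!: derivative_eq_intros simp: fun_eq_iff scaleR_conv_of_real)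
    hence "((alt_dilog \<circ> (\<lambda>t. of_real r * cis (2 * pi * t))) has_vector_derivative
             2 * pi * \<i> * z * d) (at t)"
      using d(1) unfolding z_def by (rule field_vector_diff_chain_at)
    hence "((\<lambda>t. Im (alt_dilog (of_real r * cis (2 * pi * t)))) has_vector_derivative
             Im (2 * pi * \<i> * z * d)) (at t)"
      unfolding o_def by (rule bounded_linear.has_vector_derivative[OF bounded_linear_Im])
    hence "((\<lambda>t. Im (alt_dilog (of_real r * cis (2 * pi * t))) / (2 * pi)) has_vector_derivative
             Im (2 * pi * \<i> * z * d) / (2 * pi)) (at t)"
      by (rule has_vector_derivative_divide)
    thus ?thesis
      unfolding F_def im by (simp only: z_def)
  qed
  hence "((\<lambda>t. ln (cmod (1 + of_real r * cis (2 * pi * t)))) has_integral F b - F a) {a..b}"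
    using assms(1)
    by (intro fundamental_theorem_of_calculus) (auto intro: has_vector_derivative_at_within)
  thus ?thesis
    by (simp add: F_def diff_divide_distrib)
qed

lemma integral_ln_norm_one_plus_cis:
  assumes "a \<le> b" and cos: "\<And>t. a \<le> t \<Longrightarrow> t \<le> b \<Longrightarrow> - 1 / 2 \<le> cos (2 * pi * t)"
  shows "integral {a..b} (\<lambda>t. ln (cmod (1 + cis (2 * pi * t)))) =
           (Im (alt_dilog (cis (2 * pi * b))) - Im (alt_dilog (cis (2 * pi * a)))) / (2 * pi)"
proof -
  define f where "f r t = ln (cmod (1 + of_real r * cis (2 * pi * t)))" for r t :: real
  define r where "r m = 1 - inverse (real (Suc m))" for m
  have r_bounds: "0 \<le> r m" "r m < 1" for m
    by (auto simp: r_def field_simps)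
  have r_lim: "r \<longlonglongrightarrow> 1"
    using tendsto_diff[OF tendsto_const LIMSEQ_inverse_real_of_nat, of 1] unfolding r_def by simp
  have ge: "1 / 2 \<le> cmod (1 + of_real s * cis (2 * pi * t))" if "0 \<le> s" "s \<le> 1" "t \<in> {a..b}" for s t
    using that cos by (intro norm_one_plus_cis_ge) auto
  have cont: "continuous_on {a..b} (f s)" if "0 \<le> s" "s \<le> 1" for s
    unfolding f_def cis_conv_exp using ge[OF that, unfolded cis_conv_exp]
    by (intro continuous_intros) force
  have bound: "norm (integral {a..b} (f (r m)) - integral {a..b} (f 1)) \<le> 2 * (1 - r m) * (b - a)" for m
  proof -
    have r: "0 \<le> r m" "r m \<le> 1"
      using r_bounds[of m] by auto
    have "integral {a..b} (f (r m)) - integral {a..b} (f 1) = integral {a..b} (\<lambda>t. f (r m) t - f 1 t)"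
      using r by (intro integral_diff[symmetric] integrable_continuous_real cont) auto
    also have "norm \<dots> \<le> 2 * (1 - r m) * (b - a)"
    proof (intro integral_bound continuous_on_diff cont)
      fix t assume t: "t \<in> {a..b}"
      have "\<bar>f (r m) t - f 1 t\<bar> \<le>
              \<bar>cmod (1 + of_real (r m) * cis (2 * pi * t)) - cmod (1 + of_real 1 * cis (2 * pi * t))\<bar> / (1 / 2)"
        unfolding f_def using t r by (intro abs_ln_diff_le ge) auto
      also have "\<dots> \<le> cmod ((1 + of_real (r m) * cis (2 * pi * t)) - (1 + of_real 1 * cis (2 * pi * t))) / (1 / 2)"
        by (intro divide_right_mono norm_triangle_ineq3) auto
      also have "(1 + of_real (r m) * cis (2 * pi * t)) - (1 + of_real 1 * cis (2 * pi * t)) =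
                   of_real (r m - 1) * cis (2 * pi * t)"
        by (simp add: algebra_simps)
      also have "cmod \<dots> / (1 / 2) = 2 * (1 - r m)"
        using r by (simp add: norm_mult del: of_real_diff)
      finally show "norm (f (r m) t - f 1 t) \<le> 2 * (1 - r m)"
        by simp
    qed (use assms r in auto)
    finally show ?thesis .
  qed
  have "(\<lambda>m. 2 * (1 - r m) * (b - a)) \<longlonglongrightarrow> 2 * (1 - 1) * (b - a)"
    by (intro tendsto_intros r_lim)
  hence "(\<lambda>m. 2 * (1 - r m) * (b - a)) \<longlonglongrightarrow> 0"
    by simp
  hence "(\<lambda>m. integral {a..b} (f (r m)) - integral {a..b} (f 1)) \<longlonglongrightarrow> 0"
    by (rule Lim_null_comparison[rotated]) (intro always_eventually allI bound)
  hence lim: "(\<lambda>m. integral {a..b} (f (r m))) \<longlonglongrightarrow> integral {a..b} (f 1)"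
    by (rule LIM_zero_cancel)
  have radius: "integral {a..b} (f (r m)) = (Im (alt_dilog (of_real (r m) * cis (2 * pi * b)))
      - Im (alt_dilog (of_real (r m) * cis (2 * pi * a)))) / (2 * pi)" for m
    unfolding f_def using assms(1) r_bounds[of m]
    by (intro integral_unique integral_ln_norm_one_plus_cis_radius)
  have "(\<lambda>m. (Im (alt_dilog (of_real (r m) * cis (2 * pi * b)))
      - Im (alt_dilog (of_real (r m) * cis (2 * pi * a)))) / (2 * pi)) \<longlonglongrightarrow>
      (Im (alt_dilog (cis (2 * pi * b))) - Im (alt_dilog (cis (2 * pi * a)))) / (2 * pi)"
    by (intro tendsto_intros alt_dilog_radial_limit r_lim) (use r_bounds in \<open>auto intro: less_imp_le\<close>)
  hence "integral {a..b} (f 1) =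
      (Im (alt_dilog (cis (2 * pi * b))) - Im (alt_dilog (cis (2 * pi * a)))) / (2 * pi)"
    by (rule LIMSEQ_unique[OF lim[unfolded radius]])
  thus ?thesis
    by (simp add: f_def[abs_def])
qed

lemma dirichlet_L_chi3_real:
  obtains S where "dirichlet_L 2 chi3 = of_real S"
    "(\<lambda>n. Re (chi3 (int n)) / real n ^ 2) sums S"
proof -
  define a where "a n = Re (chi3 (int n)) / real n ^ 2" for n
  have term_eq: "chi3 (int (Suc n)) / of_nat (Suc n) powr 2 = of_real (a (Suc n))" for n
  proof -
    have "(of_nat (Suc n) :: complex) powr 2 = of_nat (Suc n) ^ 2"
      using powr_nat'[of "of_nat (Suc n) :: complex" 2] by (simp del: of_nat_Suc)
    moreover have "chi3 (int (Suc n)) = of_real (Re (chi3 (int (Suc n))))"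
      by (simp add: chi3_def)
    ultimately show ?thesis
      by (simp add: a_def del: of_nat_Suc)
  qed
  have "summable (\<lambda>n. a (Suc n))"
    using summable_dirichlet_L_2_chi3 unfolding term_eq by (rule summable_of_real_iff[THEN iffD1])
  then obtain S where sums: "(\<lambda>n. a (Suc n)) sums S"
    by (auto simp: summable_def)
  hence "dirichlet_L 2 chi3 = of_real S"
    unfolding dirichlet_L_def term_eq by (intro sums_unique[symmetric] sums_of_real)
  moreover have "a sums S"
    using sums by (subst (asm) sums_Suc_iff) (simp add: a_def)
  ultimately show thesis
    unfolding a_def[abs_def] by (rule that)
qed

lemma chi3_alternating_sums:
  assumes "(\<lambda>n. Re (chi3 (int n)) / real n ^ 2) sums S"
  shows "(\<lambda>n. (-1) ^ Suc n * (Re (chi3 (int n)) / real n ^ 2)) sums (3 / 2 * S)"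
proof -
  define a where "a n = Re (chi3 (int n)) / real n ^ 2" for n
  have a: "a sums S"
    using assms by (simp add: a_def[abs_def])
  have "chi3 (2 * int n) = - chi3 (int n)" for n
  proof -
    have "(2 * int n) mod 3 = (2 * (int n mod 3)) mod 3"
      by (simp add: mod_mult_right_eq)
    thus ?thesis
      by (cases "int n" rule: mod3_cases) (simp_all add: chi3_def)
  qed
  hence "a (2 * n) = a n * (- 1 / 4)" for n
    by (simp add: a_def power_mult_distrib)
  hence "(\<lambda>n. a (2 * n)) sums (S * (- 1 / 4))"
    using sums_mult2[OF a, of "- 1 / 4"] by (simp only:)
  also have "(\<lambda>n. a (2 * n)) = (\<lambda>n. if even (2 * n) then a (2 * n) else 0)"
    by simp
  finally have "(\<lambda>n. if even n then a n else 0) sums (S * (- 1 / 4))"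
    by (subst (asm) sums_mono_reindex) (auto simp: strict_mono_def elim!: evenE)
  hence "(\<lambda>n. a n - 2 * (if even n then a n else 0)) sums (S - 2 * (S * (- 1 / 4)))"
    by (intro sums_diff sums_mult a)
  also have "(\<lambda>n. a n - 2 * (if even n then a n else 0)) = (\<lambda>n. (-1) ^ Suc n * a n)"
    by auto
  finally show ?thesis
    by (simp add: a_def)
qed

lemma Im_cube_root_of_unity_power:
  assumes "w ^ 3 = 1" "Im (w ^ 2) = - Im w"
  shows "Im (w ^ n) = Im w * Re (chi3 (int n))"
proof -
  have "w ^ n = w ^ (3 * (n div 3) + n mod 3)"
    by simp
  also have "\<dots> = w ^ (n mod 3)"
    by (simp only: power_add power_mult assms(1)) simp
  finally have *: "w ^ n = w ^ (n mod 3)" .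
  have "int n mod 3 = int (n mod 3)"
    by (simp add: zmod_int)
  moreover have "n mod 3 = 0 \<or> n mod 3 = 1 \<or> n mod 3 = 2"
    by linarith
  ultimately show ?thesis
    using assms(2) unfolding * chi3_def by auto
qed

lemma Im_alt_dilog_cube_root:
  assumes "w ^ 3 = 1" "Im (w ^ 2) = - Im w"
    and S: "(\<lambda>n. Re (chi3 (int n)) / real n ^ 2) sums S"
  shows "Im (alt_dilog w) = Im w * (3 / 2 * S)"
proof -
  have w: "cmod w = 1"
    using norm_root_of_unity[OF assms(1)] by simp
  have "(\<lambda>n. Im ((-1) ^ Suc n / of_nat n ^ 2 * w ^ n)) sums Im (alt_dilog w)"
    unfolding alt_dilog_def using w by (intro sums_Im summable_sums summable_alt_dilog) auto
  moreover have "Im ((-1) ^ Suc n / of_nat n ^ 2 * w ^ n) =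
                   Im w * ((-1) ^ Suc n * (Re (chi3 (int n)) / real n ^ 2))" for n
  proof -
    have "(-1) ^ Suc n / of_nat n ^ 2 * w ^ n = of_real ((-1) ^ Suc n / real n ^ 2) * w ^ n"
      by simp
    also have "Im \<dots> = (-1) ^ Suc n / real n ^ 2 * Im (w ^ n)"
      by (simp only: Im_complex_of_real Re_complex_of_real times_complex.sel mult_zero_left add_0_right)
    also have "\<dots> = Im w * ((-1) ^ Suc n * (Re (chi3 (int n)) / real n ^ 2))"
      by (simp add: Im_cube_root_of_unity_power[OF assms(1,2)])
    finally show ?thesis .
  qed
  ultimately have "(\<lambda>n. Im w * ((-1) ^ Suc n * (Re (chi3 (int n)) / real n ^ 2))) sums Im (alt_dilog w)"
    by (simp only:)
  moreover have "(\<lambda>n. Im w * ((-1) ^ Suc n * (Re (chi3 (int n)) / real n ^ 2))) sums (Im w * (3 / 2 * S))"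
    using chi3_alternating_sums[OF S] by (rule sums_mult)
  ultimately show ?thesis
    by (rule sums_unique2)
qed

section \<open>The asymptotics\<close>

lemma integral_ln_plus_norm_one_plus_cis:
  assumes S: "(\<lambda>n. Re (chi3 (int n)) / real n ^ 2) sums S"
  shows "integral {0..1} (\<lambda>t. ln_plus (cmod (1 + cis (2 * pi * t)))) = 3 * sqrt 3 / (4 * pi) * S"
proof -
  define h where "h t = ln_plus (cmod (1 + cis (2 * pi * t)))" for t
  have norm_sq: "cmod (1 + cis x) ^ 2 = 2 + 2 * cos x" for x
    using sin_cos_squared_add[of x]
    by (simp add: cmod_power2) (simp add: power2_eq_square algebra_simps)
  have cos_bounds: "- 1 / 2 \<le> cos (2 * pi * t)" if "t \<in> {0..1/3} \<union> {2/3..1}" for t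
  proof -
    define s where "s = min t (1 - t)"
    have "cos (2 * pi * (1 - t)) = cos (2 * pi * t)"
      using cos_diff[of "2 * pi" "2 * pi * t"] by (simp add: algebra_simps)
    hence "cos (2 * pi * t) = cos (2 * pi * s)"
      by (auto simp: s_def min_def)
    moreover have s: "0 \<le> s" "s \<le> 1 / 3"
      using that by (auto simp: s_def)
    have "pi * (2 * s) \<le> pi * (2 / 3)"
      using s by (intro mult_left_mono) auto
    hence "cos (2 * pi / 3) \<le> cos (2 * pi * s)"
      using s by (intro cos_monotone_0_pi_le) (auto simp: mult_ac)
    ultimately show ?thesis
      by (simp add: cos_120)
  qed
  have cos_middle: "cos (2 * pi * t) \<le> - 1 / 2" if "t \<in> {1/3..2/3}" for t
  proof -
    have "\<bar>2 * t - 1\<bar> \<le> 1 / 3"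
      using that by (intro abs_leI) auto
    hence "pi * \<bar>2 * t - 1\<bar> \<le> pi * (1 / 3)"
      by (intro mult_left_mono) auto
    hence "\<bar>pi * (2 * t - 1)\<bar> \<le> pi * (1 / 3)"
      by (simp only: abs_mult abs_of_pos[OF pi_gt_zero])
    hence "cos (pi / 3) \<le> cos \<bar>pi * (2 * t - 1)\<bar>"
      by (intro cos_monotone_0_pi_le) auto
    also have "\<dots> = - cos (2 * pi * t)"
      using cos_diff[of "2 * pi * t" pi] by (simp add: algebra_simps)
    finally show ?thesis
      by (simp add: cos_60)
  qed
  have outer: "integral A h = integral A (\<lambda>t. ln (cmod (1 + cis (2 * pi * t))))"
    if "A \<subseteq> {0..1/3} \<union> {2/3..1}" for A
  proof (rule integral_cong)
    fix t assume "t \<in> A"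
    hence "1 \<le> cmod (1 + cis (2 * pi * t)) ^ 2"
      using that cos_bounds[of t] unfolding norm_sq by auto
    hence "1 \<le> cmod (1 + cis (2 * pi * t))"
      using power2_le_imp_le[of 1 "cmod (1 + cis (2 * pi * t))"] by simp
    thus "h t = ln (cmod (1 + cis (2 * pi * t)))"
      by (simp add: h_def ln_plus_def)
  qed
  have middle: "integral {1/3..2/3} h = integral {1/3..2/3} (\<lambda>_ :: real. 0)"
  proof (rule integral_cong)
    fix t :: real assume "t \<in> {1/3..2/3}"
    hence "cmod (1 + cis (2 * pi * t)) ^ 2 \<le> 1 ^ 2"
      using cos_middle[of t] unfolding norm_sq by simp
    hence "cmod (1 + cis (2 * pi * t)) \<le> 1"
      by (rule power2_le_imp_le) simp
    thus "h t = 0"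
      by (simp add: h_def ln_plus_def)
  qed
  define w where "w = cis (2 * pi * (1 / 3))"
  have w: "w ^ 3 = 1" "w ^ 2 = cnj w" "cnj w = cis (2 * pi * (2 / 3))" "Im w = sqrt 3 / 2"
  proof -
    show w3: "w ^ 3 = 1"
      by (simp add: w_def Complex.DeMoivre)
    have "w ^ 2 * w = cnj w * w"
      using w3 complex_norm_square[of w] by (simp add: power2_eq_square power3_eq_cube w_def mult_ac)
    thus w2: "w ^ 2 = cnj w"
      by (simp add: w_def)
    show "cnj w = cis (2 * pi * (2 / 3))"
      unfolding w2[symmetric] by (simp add: w_def Complex.DeMoivre)
    show "Im w = sqrt 3 / 2"
      by (simp add: w_def sin_120)
  qed
  have dilog1: "Im (alt_dilog w) = Im w * (3 / 2 * S)"
    by (rule Im_alt_dilog_cube_root[OF _ _ S]) (simp_all add: w(1,2))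
  have dilog2: "Im (alt_dilog (cnj w)) = Im (cnj w) * (3 / 2 * S)"
    by (rule Im_alt_dilog_cube_root[OF _ _ S]) (simp_all add: w(1,2) flip: complex_cnj_power)
  have dilog0: "Im (alt_dilog 1) = 0"
    using Im_alt_dilog_cube_root[OF _ _ S, of 1] by simp
  have cont: "continuous_on A h" for A
    unfolding h_def ln_plus_def cis_conv_exp by (intro continuous_intros) auto
  have "integral {0..1} h = integral {0..1/3} h + (integral {1/3..2/3} h + integral {2/3..1} h)"
    by (simp add: Henstock_Kurzweil_Integration.integral_combine integrable_continuous_real cont)
  also have "integral {1/3..2/3} h = 0"
    unfolding middle by simp
  also have "integral {0..1/3} h = (Im (alt_dilog w) - Im (alt_dilog 1)) / (2 * pi)"
    using integral_ln_norm_one_plus_cis[of 0 "1/3"] cos_bounds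
    by (subst outer) (auto simp: w_def)
  also have "integral {2/3..1} h = (Im (alt_dilog 1) - Im (alt_dilog (cnj w))) / (2 * pi)"
    using integral_ln_norm_one_plus_cis[of "2/3" 1] cos_bounds
    by (subst outer) (auto simp: w(3))
  also have "(Im (alt_dilog w) - Im (alt_dilog 1)) / (2 * pi) +
      (0 + (Im (alt_dilog 1) - Im (alt_dilog (cnj w))) / (2 * pi)) = 3 * sqrt 3 / (4 * pi) * S"
    by (simp add: dilog0 dilog1 dilog2 w(4) field_simps)
  finally show ?thesis
    by (simp add: h_def[abs_def])
qed

lemma sum_ln_plus_roots_of_unity:
  assumes S: "(\<lambda>n. Re (chi3 (int n)) / real n ^ 2) sums S" and "N > 0"
  shows "\<bar>(\<Sum>z | z ^ N = 1. ln_plus (cmod (1 + z))) - N * (3 * sqrt 3 / (4 * pi) * S)\<bar> \<le> 2 * pi"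
proof -
  let ?h = "\<lambda>t. ln_plus (cmod (1 + cis (2 * pi * t)))"
  have "\<bar>?h s - ?h t\<bar> \<le> 2 * pi * \<bar>s - t\<bar>" for s t
  proof -
    have "\<bar>?h s - ?h t\<bar> \<le> \<bar>cmod (1 + cis (2 * pi * s)) - cmod (1 + cis (2 * pi * t))\<bar>"
      by (rule ln_plus_lipschitz)
    also have "\<dots> \<le> cmod (cis (2 * pi * s) - cis (2 * pi * t))"
      using norm_triangle_ineq3[of "1 + cis (2 * pi * s)" "1 + cis (2 * pi * t)"] by simp
    also have "\<dots> \<le> \<bar>2 * pi * s - 2 * pi * t\<bar>"
      by (rule norm_cis_diff_le)
    also have "\<dots> = 2 * pi * \<bar>s - t\<bar>"
      by (simp add: abs_mult flip: right_diff_distrib)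
    finally show ?thesis .
  qed
  hence "\<bar>(\<Sum>k<N. ?h (k / N)) - N * integral {0..1} ?h\<bar> \<le> 2 * pi"
    using assms(2) by (rule riemann_sum_lipschitz)
  moreover have "(\<Sum>k<N. ?h (k / N)) = (\<Sum>z | z ^ N = 1. ln_plus (cmod (1 + z)))"
    using sum.reindex_bij_betw[OF Complex.bij_betw_roots_unity[OF assms(2)],
        of "\<lambda>z. ln_plus (cmod (1 + z))"] by simp
  ultimately show ?thesis
    by (simp only: integral_ln_plus_norm_one_plus_cis[OF S])
qed

lemma ln_card_quotient_ring:
  assumes "N > 0" "\<not> 6 dvd N"
  shows "finite (carrier (quotient_ring N))"
    and "ln (card (carrier (quotient_ring N))) = (\<Sum>z | z ^ N = 1. ln (cmod ((1 + z) ^ N - 1)))"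
proof -
  define f g :: "int poly" where "f = [:0, 1:] ^ N - 1" and "g = ([:0, 1:] + 1) ^ N - 1"
  have f: "poly (of_int_poly f) z = z ^ N - 1" for z :: complex
    by (simp add: f_def of_int_poly_hom.hom_minus of_int_poly_hom.hom_power)
  have g: "poly (of_int_poly g) z = (1 + z) ^ N - 1" for z :: complex
    by (simp add: g_def of_int_poly_hom.hom_minus of_int_poly_hom.hom_power
          of_int_poly_hom.hom_add add.commute)
  have roots: "{z :: complex. poly (of_int_poly f) z = 0} = {z. z ^ N = 1}"
    by (simp add: f)
  have f_monom: "f = monom 1 N + [:-1:]"
    by (simp add: f_def monom_altdef one_pCons diff_conv_add_uminus del: add_uminus_conv_diff)
  have deg: "degree f = N"
    unfolding f_monom using assms(1) by (subst degree_add_eq_left) (simp_all add: degree_monom_eq)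
  have monic: "lead_coeff f = 1"
    unfolding deg unfolding f_monom using assms(1) by (simp add: coeff_pCons split: nat.split)
  have sep: "card {z :: complex. poly (of_int_poly f) z = 0} = degree f"
    unfolding roots deg using assms(1) by (rule card_roots_unity_eq)
  have nz: "(1 + z) ^ N - 1 \<noteq> 0" if "z ^ N = 1" for z :: complex
    using norm_power_minus_one_bounds(1)[OF that assms] by auto
  have Q: "quotient_ring N = int_poly_ring Quot (Idl\<^bsub>int_poly_ring\<^esub> {f, g})"
    by (simp add: quotient_ring_def f_def g_def)
  note card_int_poly_quotient[OF monic sep, of g, unfolded f g, folded Q]
  hence fin: "finite (carrier (quotient_ring N))"
    and card: "real (card (carrier (quotient_ring N))) = (\<Prod>z | z ^ N = 1. cmod ((1 + z) ^ N - 1))"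
    using nz by auto
  show "finite (carrier (quotient_ring N))"
    by (rule fin)
  show "ln (card (carrier (quotient_ring N))) = (\<Sum>z | z ^ N = 1. ln (cmod ((1 + z) ^ N - 1)))"
    unfolding card using finite_roots_unity[of N] assms(1) nz by (subst ln_prod) auto
qed

theorem proposition4p3:
  shows "\<exists>\<kappa>::real. \<kappa> > 0 \<and> (\<exists>C::real. \<forall>N::nat. N \<ge> 1 \<and> \<not> 6 dvd N \<longrightarrow>
           finite (carrier (quotient_ring N)) \<and>
           norm (complex_of_real (ln (real (card (carrier (quotient_ring N)))))
                 - complex_of_real (3 * sqrt 3 / (4 * pi)) * dirichlet_L 2 chi3 * of_nat N ^ 2)
             \<le> C * real N powr (2 - \<kappa>))"
proof (rule exI[of _ 1], intro exI[of _ "ln 4 + 2 * pi"] conjI allI impI)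
  fix N :: nat assume "1 \<le> N \<and> \<not> 6 dvd N"
  hence N: "N > 0" "\<not> 6 dvd N"
    by auto
  show "finite (carrier (quotient_ring N))"
    using N by (rule ln_card_quotient_ring)
  obtain S where L: "dirichlet_L 2 chi3 = of_real S"
    and S: "(\<lambda>n. Re (chi3 (int n)) / real n ^ 2) sums S"
    by (rule dirichlet_L_chi3_real)
  define c where "c = 3 * sqrt 3 / (4 * pi)"
  define A where "A = ln (card (carrier (quotient_ring N)))"
  define B where "B = (\<Sum>z | z ^ N = 1. ln_plus (cmod (1 + z)))"
  have "A - N * B = (\<Sum>z | z ^ N = 1. ln (cmod ((1 + z) ^ N - 1)) - N * ln_plus (cmod (1 + z)))"
    using ln_card_quotient_ring(2)[OF N] by (simp add: A_def B_def sum_subtractf sum_distrib_left)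
  also have "\<bar>\<dots>\<bar> \<le> (\<Sum>z :: complex | z ^ N = 1. ln 4)"
    using ln_norm_power_minus_one[OF _ N] by (intro order.trans[OF sum_abs] sum_mono) auto
  also have "\<dots> = N * ln 4"
    using N(1) by (simp add: card_roots_unity_eq)
  finally have "\<bar>A - N * B\<bar> \<le> N * ln 4" .
  moreover have "\<bar>N * B - c * S * N ^ 2\<bar> \<le> N * (2 * pi)"
  proof -
    have "\<bar>N * B - c * S * N ^ 2\<bar> = N * \<bar>B - N * (c * S)\<bar>"
      by (simp add: abs_mult_pos' right_diff_distrib power2_eq_square mult_ac)
    also have "\<dots> \<le> N * (2 * pi)"
      using sum_ln_plus_roots_of_unity[OF S N(1)]
      unfolding B_def c_def by (intro mult_left_mono) auto
    finally show ?thesis .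
  qed
  ultimately have "\<bar>A - c * S * N ^ 2\<bar> \<le> (ln 4 + 2 * pi) * N"
    by (simp add: algebra_simps)
  moreover have "complex_of_real A - complex_of_real c * of_real S * of_nat N ^ 2 =
                   of_real (A - c * S * N ^ 2)"
    by simp
  ultimately show "norm (complex_of_real (ln (real (card (carrier (quotient_ring N)))))
                 - complex_of_real (3 * sqrt 3 / (4 * pi)) * dirichlet_L 2 chi3 * of_nat N ^ 2)
             \<le> (ln 4 + 2 * pi) * real N powr (2 - 1)"
    unfolding L A_def[symmetric] c_def[symmetric] using N(1) by (simp only: norm_of_real) simp
qed simp

end
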